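(* For any $k\ge1$ and any $a_1,\dots,a_k\in\mathbb Z$, \begin{align*} \delta\,\bar{\mathfrak z}_q(a_1,\dots,a_k) &=\Big(k-\sum_{r=1}^k a_r(k-r+1)\Big)\bar{\mathfrak z}_q(a_1,\dots,a_k)\\ &\quad+\sum_{r=1}^k a_r(k-r+1)\,\bar{\mathfrak z}_q(a_1,\dots,a_r+1,\dots,a_k)\\ &\quad+\sum_{s=1}^k\Big(1-\sum_{r=1}^s a_r\Big)\bar{\mathfrak z}_q(a_1,\dots,a_s,0,a_{s+1},\dots,a_k)\\ &\quad+\sum_{1\le r\le s\le k}a_r\,\bar{\mathfrak z}_q(a_1,\dots,a_r+1,\dots,a_s,0,a_{s+1},\dots,a_k). \end{align*} Here $a_r+1$ means that the $r$-th argument is increased by one, and the $0$ is inserted immediately after the $s$-th argument (at the end if $s=k$); for $r=s$ the summand in the last line has $s$-th argument $a_s+1$ followed by $0$.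
   Context: For $k\ge1$ and $n_1,\dots,n_k\in\mathbb Z$, the modified $q$-multiple zeta value is $$\bar{\mathfrak z}_q(n_1,\dots,n_k)=\sum_{m_1>\cdots>m_k>0}\frac{q^{m_1}}{(1-q^{m_1})^{n_1}\cdots(1-q^{m_k})^{n_k}},$$ an element of $q\,\mathbb Q[[q]]$ (the series also converges for every complex $q$ with $|q|<1$). $\delta=q\frac{d}{dq}$. *)

theory Defs
  imports "HOL-Analysis.Analysis"
begin

definition index_tuples :: "nat \<Rightarrow> nat list set" where
  "index_tuples k = {ms. length ms = k \<and> sorted_wrt (>) ms \<and> (\<forall>m\<in>set ms. m > 0)}"

definition qmzv_term :: "int list \<Rightarrow> nat list \<Rightarrow> rat fps" where
  "qmzv_term ns ms =
     fps_X ^ hd ms / (\<Prod>i<length ns. (1 - fps_X ^ (ms ! i)) powi (ns ! i))"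

text \<open>
  The indeterminate \<open>fps_X\<close> plays the role of \<open>q\<close>, and the sum is taken in the \<open>q\<close>-adic topology of
  the ring of formal power series; it always converges, as shown below. The value at the empty
  list is meaningless, since there is no largest index \<open>m\<^sub>1\<close>.
\<close>
definition qmzv :: "int list \<Rightarrow> rat fps" where
  "qmzv ns = (\<Sum>\<^sub>\<infinity>ms\<in>index_tuples (length ns). qmzv_term ns ms)"

definition q_deriv :: "rat fps \<Rightarrow> rat fps" where
  "q_deriv f = fps_X * fps_deriv f"

text \<open>Both operations count argument positions from 1.\<close>

definition incr_arg :: "nat \<Rightarrow> int list \<Rightarrow> int list" where
  "incr_arg r as = as[r - 1 := as ! (r - 1) + 1]"

definition insert_zero_after :: "nat \<Rightarrow> int list \<Rightarrow> int list" where
  "insert_zero_after s as = take s as @ 0 # drop s as"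

lemma index_tuples_le_hd:
  assumes "ms \<in> index_tuples k" "m \<in> set ms"
  shows "m \<le> hd ms"
  using assms by (cases ms) (auto simp: index_tuples_def)

lemma finite_index_tuples_hd_le: "finite {ms \<in> index_tuples k. hd ms \<le> N}"
proof (rule finite_subset)
  show "{ms \<in> index_tuples k. hd ms \<le> N} \<subseteq> {ms. set ms \<subseteq> {..N} \<and> length ms = k}"
    using index_tuples_le_hd by (fastforce simp: index_tuples_def)
qed (auto intro: finite_lists_length_eq)

lemma unit_powi_nth_0:
  fixes f :: "rat fps"
  assumes "fps_nth f 0 = 1"
  shows "fps_nth (f powi n) 0 = 1"
  using assms by (simp add: power_int_def fps_power_zeroth)

lemma qmzv_term_denominator_nth_0:
  assumes "ms \<in> index_tuples (length ns)"
  shows "fps_nth (\<Prod>i<length ns. (1 - fps_X ^ (ms ! i) :: rat fps) powi (ns ! i)) 0 = 1"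
proof -
  have "fps_nth ((1 - fps_X ^ (ms ! i) :: rat fps) powi (ns ! i)) 0 = 1" if "i < length ns" for i
    using assms that by (intro unit_powi_nth_0) (auto simp: index_tuples_def)
  moreover have "fps_nth (\<Prod>i\<in>A. f i) 0 = (\<Prod>i\<in>A. fps_nth (f i) 0)"
    for A and f :: "nat \<Rightarrow> rat fps"
    by (induction A rule: infinite_finite_induct) auto
  ultimately show ?thesis
    by simp
qed

lemma qmzv_term_nth_eq_0:
  assumes "ms \<in> index_tuples (length ns)" "n < hd ms"
  shows "fps_nth (qmzv_term ns ms) n = 0"
  using assms qmzv_term_denominator_nth_0[OF assms(1)]
  by (simp add: qmzv_term_def fps_divide_unit fps_X_power_mult_nth)

lemma qmzv_has_sum:
  "(qmzv_term ns has_sum qmzv ns) (index_tuples (length ns))"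
proof -
  let ?A = "index_tuples (length ns)"
  let ?S = "Abs_fps (\<lambda>n. \<Sum>ms | ms \<in> ?A \<and> fps_nth (qmzv_term ns ms) n \<noteq> 0. fps_nth (qmzv_term ns ms) n)"
  have "(qmzv_term ns has_sum ?S) ?A"
  proof (rule has_sum_fpsI)
    fix n
    have "{ms \<in> ?A. fps_nth (qmzv_term ns ms) n \<noteq> 0} \<subseteq> {ms \<in> ?A. hd ms \<le> n}"
      using qmzv_term_nth_eq_0 by (auto simp: not_less[symmetric])
    then show "finite {ms \<in> ?A. fps_nth (qmzv_term ns ms) n \<noteq> 0}"
      using finite_index_tuples_hd_le finite_subset by blast
  qed simp
  then show ?thesis
    by (simp add: qmzv_def infsumI)
qed

end

theory Submission
  imports Defs
begin

text \<open>
  Write \<open>T a m\<close> for the summand of index \<open>m = (m\<^sub>1, \<dots>, m\<^sub>k)\<close>. Its logarithmic derivative is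
  \<open>m\<^sub>1 + (\<Sum>r. a\<^sub>r m\<^sub>r (1 / (1 - q ^ m\<^sub>r) - 1))\<close>, and multiplication by \<open>1 / (1 - q ^ m\<^sub>r)\<close> increases \<open>a\<^sub>r\<close>
  by one, so \<open>\<delta>\<close> of the zeta value is a combination of moments \<open>\<Sum>m. m\<^sub>r T b m\<close>. Inserting a zero
  after position \<open>s\<close> weights \<open>T b m\<close> by the number \<open>m\<^sub>s - m\<^sub>s\<^sub>+\<^sub>1 - 1\<close> of integers strictly between
  \<open>m\<^sub>s\<^sub>+\<^sub>1\<close> and \<open>m\<^sub>s\<close> (with \<open>m\<^sub>k\<^sub>+\<^sub>1 = 0\<close>). Summing over \<open>s \<ge> r\<close> telescopes to \<open>m\<^sub>r - (k - r + 1)\<close>, which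
  expresses the moments through zeta values.
\<close>


section \<open>Logarithmic derivatives with respect to \<open>q_deriv\<close>\<close>

lemma q_deriv_1 [simp]: "q_deriv 1 = 0"
  by (simp add: q_deriv_def)

lemma q_deriv_mult: "q_deriv (f * g) = q_deriv f * g + f * q_deriv g"
  by (simp add: q_deriv_def algebra_simps)

text \<open>The factor \<open>d\<close> is the logarithmic derivative of \<open>f\<close>. The
  multiplicative form avoids dividing by \<open>f\<close>, which need not be a unit.\<close>

lemma q_deriv_power_log:
  assumes "q_deriv f = d * f"
  shows "q_deriv (f ^ n) = of_nat n * d * f ^ n"
  by (induction n) (simp_all add: assms q_deriv_mult algebra_simps)

lemma q_deriv_prod_log:
  assumes "\<And>i. i \<in> A \<Longrightarrow> q_deriv (f i) = d i * f i"
  shows "q_deriv (\<Prod>i\<in>A. f i) = (\<Sum>i\<in>A. d i) * (\<Prod>i\<in>A. f i)"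
  using assms
proof (induction A rule: infinite_finite_induct)
  case (insert x A)
  then show ?case by (simp add: q_deriv_mult algebra_simps)
qed (simp_all add: q_deriv_def)

lemma q_deriv_fps_X_power: "q_deriv (fps_X ^ m) = of_nat m * fps_X ^ m"
  using q_deriv_power_log[of fps_X 1 m] by (simp add: q_deriv_def)

section \<open>Integer powers of 1/(1 - q^m)\<close>

definition geo :: "nat \<Rightarrow> rat fps" where
  "geo m = inverse (1 - fps_X ^ m)"

text \<open>Power series do not form a field, so exponent laws are obtained by reducing the two
  signs of \<open>n\<close> to natural powers of \<open>geo m\<close> and of
  \<open>1 - fps_X ^ m\<close>.\<close>

definition qfactor :: "nat \<Rightarrow> int \<Rightarrow> rat fps" where
  "qfactor m n = inverse ((1 - fps_X ^ m) powi n)"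

lemma geo_mult:
  assumes "m > 0" shows "(1 - fps_X ^ m) * geo m = 1"
  using assms by (simp add: geo_def inverse_mult_eq_1')

lemma qfactor_0 [simp]: "qfactor m 0 = 1"
  by (simp add: qfactor_def)

lemma qfactor_nonneg:
  assumes "n \<ge> 0" shows "qfactor m n = geo m ^ nat n"
  using assms by (simp add: qfactor_def geo_def power_int_def fps_inverse_power)

lemma qfactor_nonpos:
  assumes "m > 0" "n \<le> 0" shows "qfactor m n = (1 - fps_X ^ m) ^ nat (- n)"
proof -
  \<comment> \<open>Since \<open>m > 0\<close>, the constant term is 1, so inverting twice gives the
    power back.\<close>
  have "fps_nth ((1 - fps_X ^ m :: rat fps) ^ nat (- n)) 0 \<noteq> 0"
    using assms by (auto simp: fps_power_zeroth power_0_left)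
  then show ?thesis
    using assms(2) by (auto simp: qfactor_def power_int_def fps_inverse_idempotent
        simp flip: fps_inverse_power)
qed

lemma qfactor_Suc:
  assumes "m > 0" shows "qfactor m (n + 1) = geo m * qfactor m n"
proof (cases "n \<ge> 0")
  case True
  then show ?thesis by (simp add: qfactor_nonneg nat_add_distrib)
next
  case False
  \<comment> \<open>For negative \<open>n\<close> the power of \<open>1 - fps_X ^ m\<close> has a
    spare factor, which \<open>geo m\<close> cancels.\<close>
  have "nat (- n) = Suc (nat (- (n + 1)))" using False by simp
  then show ?thesis using False assms geo_mult[OF assms]
    by (simp add: qfactor_nonpos mult.assoc[symmetric] mult.commute)
qed

text \<open>Differentiate \<open>(1 - fps_X ^ m) * geo m = 1\<close>, then multiply by
  \<open>geo m\<close> to isolate the derivative. The form \<open>geo m - 1\<close> of q^m/(1 - q^m)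
  is chosen because \<open>geo m\<close> can be absorbed into an exponent.\<close>

lemma q_deriv_geo:
  assumes "m > 0" shows "q_deriv (geo m) = of_nat m * (geo m - 1) * geo m"
proof -
  have X: "fps_X ^ m * geo m = geo m - 1"
    using geo_mult[OF assms] by (simp add: algebra_simps)
  have "0 = q_deriv ((1 - fps_X ^ m) * geo m)"
    using geo_mult[OF assms] by (simp add: q_deriv_def)
  also have "\<dots> = - (of_nat m * (fps_X ^ m * geo m)) + (1 - fps_X ^ m) * q_deriv (geo m)"
    using q_deriv_fps_X_power[of m] unfolding q_deriv_mult
    by (simp add: q_deriv_def algebra_simps)
  finally have "(1 - fps_X ^ m) * q_deriv (geo m) = of_nat m * (geo m - 1)"
    by (simp add: X)
  then have "(1 - fps_X ^ m) * geo m * q_deriv (geo m) = of_nat m * (geo m - 1) * geo m"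
    by (simp only: mult.assoc mult.left_commute[of _ "geo m"] mult.commute[of _ "geo m"])
  then show ?thesis
    by (simp only: geo_mult[OF assms] mult_1_left)
qed

lemma q_deriv_qfactor:
  assumes "m > 0"
  shows "q_deriv (qfactor m n) = of_int n * of_nat m * (geo m - 1) * qfactor m n"
proof (cases "n \<ge> 0")
  case True
  then obtain b where "n = int b"
    using nonneg_int_cases by blast
  then show ?thesis
    using q_deriv_power_log[OF q_deriv_geo[OF assms], of b]
    by (simp only: qfactor_nonneg of_nat_0_le_iff nat_int of_int_of_nat_eq mult.assoc)
next
  case False
  \<comment> \<open>For negative exponents the base is \<open>?u\<close>, whose logarithmic
    derivative is the negative of that of \<open>geo m\<close>; the two minus signs cancel.\<close>
  let ?u = "1 - fps_X ^ m :: rat fps"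
  have "q_deriv ?u = - of_nat m * fps_X ^ m"
    using q_deriv_fps_X_power[of m] by (simp add: q_deriv_def algebra_simps)
  moreover have "fps_X ^ m = (geo m - 1) * ?u"
    using geo_mult[OF assms] by (simp add: algebra_simps)
  ultimately have u: "q_deriv ?u = - (of_nat m * (geo m - 1)) * ?u"
    by (metis mult.assoc minus_mult_left)
  obtain b where "n = - int b"
    using False nonpos_int_cases[of n] by fastforce
  then show ?thesis
    using q_deriv_power_log[OF u, of b] qfactor_nonpos[OF assms, of n]
    by (simp only: neg_le_0_iff_le of_nat_0_le_iff minus_minus nat_int of_int_minus
        of_int_of_nat_eq mult_minus_left mult_minus_right mult.assoc)
qed

section \<open>Summands and coefficients of the zeta series\<close>

lemma qmzv_term_eq:
  assumes "ms \<in> index_tuples (length ns)"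
  shows "qmzv_term ns ms = fps_X ^ hd ms * (\<Prod>i<length ns. qfactor (ms ! i) (ns ! i))"
  unfolding qmzv_term_def qfactor_def inverse_prod_fps[symmetric]
  by (rule fps_divide_unit) (simp only: qmzv_term_denominator_nth_0[OF assms] one_neq_zero not_False_eq_True)

text \<open>Summands with \<open>hd ms > n\<close> do not reach the coefficient of q^n. The finite
  index set depends on \<open>ns\<close> only through its length, so sums for different arguments
  can be combined term by term.\<close>

lemma qmzv_nth:
  "fps_nth (qmzv ns) n =
     (\<Sum>ms | ms \<in> index_tuples (length ns) \<and> hd ms \<le> n. fps_nth (qmzv_term ns ms) n)"
proof -
  let ?A = "index_tuples (length ns)"
  let ?B = "\<lambda>n. {ms \<in> ?A. hd ms \<le> n}"
  let ?S = "Abs_fps (\<lambda>n. \<Sum>ms\<in>?B n. fps_nth (qmzv_term ns ms) n)"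
  have sub: "{ms \<in> ?A. fps_nth (qmzv_term ns ms) n \<noteq> 0} \<subseteq> ?B n" for n
    using qmzv_term_nth_eq_0 by (auto simp: not_less[symmetric])
  have "(qmzv_term ns has_sum ?S) ?A"
  proof (rule has_sum_fpsI)
    show "finite {ms \<in> ?A. fps_nth (qmzv_term ns ms) n \<noteq> 0}" for n
      using sub finite_index_tuples_hd_le finite_subset by blast
    show "fps_nth ?S n =
        (\<Sum>ms | ms \<in> ?A \<and> fps_nth (qmzv_term ns ms) n \<noteq> 0. fps_nth (qmzv_term ns ms) n)" for n
      using sub[of n] finite_index_tuples_hd_le[of "length ns" n]
      by (auto intro!: sum.mono_neutral_right)
  qed
  then have "qmzv ns = ?S"
    by (simp add: qmzv_def infsumI)
  then show ?thesis
    by simp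
qed

lemma length_incr_arg [simp]: "length (incr_arg r as) = length as"
  by (simp add: incr_arg_def)

lemma qmzv_term_incr_arg:
  assumes "ms \<in> index_tuples (length ns)" "r < length ns"
  shows "qmzv_term (incr_arg (Suc r) ns) ms = geo (ms ! r) * qmzv_term ns ms"
proof -
  have "ms ! r > 0"
    using assms by (simp add: index_tuples_def)
  moreover have "(\<Prod>i\<in>{..<length ns} - {r}. qfactor (ms ! i) (incr_arg (Suc r) ns ! i)) =
      (\<Prod>i\<in>{..<length ns} - {r}. qfactor (ms ! i) (ns ! i))"
    by (intro prod.cong) (auto simp: incr_arg_def)
  ultimately show ?thesis
    using assms by (simp add: qmzv_term_eq prod.remove[of "{..<length ns}" r] incr_arg_def qfactor_Suc)
qed

lemma q_deriv_qmzv_term: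
  assumes "ms \<in> index_tuples (length ns)"
  shows "q_deriv (qmzv_term ns ms) = of_nat (hd ms) * qmzv_term ns ms
    + (\<Sum>r<length ns. of_int (ns ! r) * (of_nat (ms ! r) * qmzv_term (incr_arg (Suc r) ns) ms
        - of_nat (ms ! r) * qmzv_term ns ms))"
proof -
  let ?P = "\<Prod>i<length ns. qfactor (ms ! i) (ns ! i)"
  let ?d = "\<lambda>i. of_int (ns ! i) * of_nat (ms ! i) * (geo (ms ! i) - 1)"
  have "q_deriv ?P = (\<Sum>i<length ns. ?d i) * ?P"
    using assms by (intro q_deriv_prod_log q_deriv_qfactor) (simp add: index_tuples_def)
  then have "q_deriv (qmzv_term ns ms) =
      of_nat (hd ms) * qmzv_term ns ms + (\<Sum>i<length ns. ?d i) * qmzv_term ns ms"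
    using assms by (simp add: qmzv_term_eq q_deriv_mult q_deriv_fps_X_power algebra_simps)
  \<comment> \<open>In \<open>geo (ms ! i) - 1\<close> the first part raises the argument at
    position \<open>i\<close> by one, the second leaves the summand unchanged.\<close>
  also have "(\<Sum>i<length ns. ?d i) * qmzv_term ns ms =
      (\<Sum>r<length ns. of_int (ns ! r) * (of_nat (ms ! r) * qmzv_term (incr_arg (Suc r) ns) ms
        - of_nat (ms ! r) * qmzv_term ns ms))"
    unfolding sum_distrib_right
    by (intro sum.cong) (use assms in \<open>simp_all add: qmzv_term_incr_arg algebra_simps\<close>)
  finally show ?thesis .
qed

text \<open>Here, and in the lemmas below, positions count from 0.\<close>

definition qmzv_moment :: "nat \<Rightarrow> int list \<Rightarrow> rat fps" where
  "qmzv_moment r ns = Abs_fps (\<lambda>n. \<Sum>ms | ms \<in> index_tuples (length ns) \<and> hd ms \<le> n.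
     of_nat (ms ! r) * fps_nth (qmzv_term ns ms) n)"

section \<open>Differentiation of the zeta series, coefficient by coefficient\<close>

lemma nth_of_nat_mult: "fps_nth (of_nat c * f :: rat fps) n = of_nat c * fps_nth f n"
  by (simp flip: fps_of_nat)

lemma nth_of_int_mult: "fps_nth (of_int c * f :: rat fps) n = of_int c * fps_nth f n"
  by (simp flip: fps_of_int)

lemma q_deriv_nth: "fps_nth (q_deriv f) n = of_nat n * fps_nth f n"
  by (cases n) (simp_all add: q_deriv_def)

text \<open>Each coefficient is a finite sum, so termwise differentiation and the exchange of sums
  need no convergence argument. For nonempty \<open>ns\<close> the exponent \<open>hd ms\<close> is
  the entry at position 0, hence the moment of index 0.\<close>

lemma q_deriv_qmzv:
  assumes "ns \<noteq> []"
  shows "q_deriv (qmzv ns) = qmzv_moment 0 ns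
    + (\<Sum>r<length ns. of_int (ns ! r) * (qmzv_moment r (incr_arg (Suc r) ns) - qmzv_moment r ns))"
proof (rule fps_ext)
  fix n
  let ?A = "{ms. ms \<in> index_tuples (length ns) \<and> hd ms \<le> n}"
  let ?c = "\<lambda>ns ms. fps_nth (qmzv_term ns ms) n"
  have "fps_nth (q_deriv (qmzv ns)) n = (\<Sum>ms\<in>?A. fps_nth (q_deriv (qmzv_term ns ms)) n)"
    by (simp add: q_deriv_nth qmzv_nth sum_distrib_left)
  also have "\<dots> = (\<Sum>ms\<in>?A. of_nat (ms ! 0) * ?c ns ms
      + (\<Sum>r<length ns. of_int (ns ! r) * (of_nat (ms ! r) * ?c (incr_arg (Suc r) ns) ms
          - of_nat (ms ! r) * ?c ns ms)))"
  proof (intro sum.cong refl)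
    fix ms assume "ms \<in> ?A"
    moreover from this assms have "hd ms = ms ! 0"
      by (intro hd_conv_nth) (auto simp: index_tuples_def)
    ultimately show "fps_nth (q_deriv (qmzv_term ns ms)) n = of_nat (ms ! 0) * ?c ns ms
      + (\<Sum>r<length ns. of_int (ns ! r) * (of_nat (ms ! r) * ?c (incr_arg (Suc r) ns) ms
          - of_nat (ms ! r) * ?c ns ms))"
      by (simp add: q_deriv_qmzv_term fps_sum_nth nth_of_nat_mult nth_of_int_mult)
  qed
  also have "\<dots> = (\<Sum>ms\<in>?A. of_nat (ms ! 0) * ?c ns ms) +
      (\<Sum>r<length ns. of_int (ns ! r) * ((\<Sum>ms\<in>?A. of_nat (ms ! r) * ?c (incr_arg (Suc r) ns) ms)
          - (\<Sum>ms\<in>?A. of_nat (ms ! r) * ?c ns ms)))"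
    by (simp add: sum.distrib right_diff_distrib sum_subtractf sum_distrib_left
        sum.swap[of _ "{..<length ns}"])
  finally show "fps_nth (q_deriv (qmzv ns)) n = fps_nth (qmzv_moment 0 ns
    + (\<Sum>r<length ns. of_int (ns ! r) * (qmzv_moment r (incr_arg (Suc r) ns) - qmzv_moment r ns))) n"
    by (simp add: qmzv_moment_def fps_sum_nth nth_of_int_mult)
qed

section \<open>Insertion of an index into a decreasing tuple\<close>

text \<open>By transitivity a new entry only has to be compared with its two neighbours. The
  appended 0 is a sentinel: when \<open>ys\<close> is empty, the comparison with the right neighbour
  becomes positivity of \<open>m\<close>.\<close>

lemma decreasing_append_Cons_iff:
  fixes xs ys :: "nat list"
  assumes "xs \<noteq> []"
  shows "sorted_wrt (>) (xs @ m # ys) \<and> (\<forall>x\<in>set (xs @ m # ys). x > 0) \<longleftrightarrow>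
    sorted_wrt (>) (xs @ ys) \<and> (\<forall>x\<in>set (xs @ ys). x > 0) \<and> hd (ys @ [0]) < m \<and> m < last xs"
proof -
  have 1: "(\<forall>x\<in>set xs. m < x) \<longleftrightarrow> m < last xs" if "sorted_wrt (>) xs"
  proof
    assume m: "m < last xs"
    show "\<forall>x\<in>set xs. m < x"
      using that m by (cases xs rule: rev_cases) (use assms in \<open>force simp: sorted_wrt_append\<close>)+
  qed (use assms in auto)
  have 2: "(\<forall>y\<in>set ys. y < m) \<and> 0 < m \<longleftrightarrow> hd (ys @ [0]) < m" if "sorted_wrt (>) ys"
    using that by (cases ys) force+
  show ?thesis
  proof (cases "sorted_wrt (>) xs \<and> sorted_wrt (>) ys")
    case True
    with 1 2 have "(\<forall>x\<in>set xs. m < x) \<longleftrightarrow> m < last xs"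
      "(\<forall>y\<in>set ys. y < m) \<and> 0 < m \<longleftrightarrow> hd (ys @ [0]) < m" by simp_all
    then show ?thesis unfolding sorted_wrt_append by (simp add: True ball_Un ball_conj_distrib) argo
  next
    case False
    then show ?thesis by (simp add: sorted_wrt_append) blast
  qed
qed

lemma last_take_eq: "s < length ms \<Longrightarrow> last (take (Suc s) ms) = ms ! s"
  by (simp add: take_Suc_conv_app_nth)

lemma hd_drop_append_eq: "s \<le> length ms \<Longrightarrow> hd (drop s ms @ [x]) = (ms @ [x]) ! s"
  by (cases "s = length ms") (simp_all add: nth_append hd_append hd_drop_conv_nth)

lemma insert_index_tuples:
  assumes "length ms = k" "s < k"
  shows "take (Suc s) ms @ m # drop (Suc s) ms \<in> index_tuples (Suc k) \<longleftrightarrow>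
    ms \<in> index_tuples k \<and> (ms @ [0]) ! Suc s < m \<and> m < ms ! s"
proof -
  let ?ms = "take (Suc s) ms @ m # drop (Suc s) ms"
  have nonempty: "take (Suc s) ms \<noteq> []"
    using assms by auto
  have "sorted_wrt (>) ?ms \<and> (\<forall>x\<in>set ?ms. x > 0) \<longleftrightarrow>
      sorted_wrt (>) ms \<and> (\<forall>x\<in>set ms. x > 0) \<and> (ms @ [0]) ! Suc s < m \<and> m < ms ! s"
    unfolding decreasing_append_Cons_iff[OF nonempty] append_take_drop_id
    using assms by (simp add: last_take_eq hd_drop_append_eq)
  moreover have "length ?ms = Suc k"
    using assms by simp
  ultimately show ?thesis
    using assms(1) unfolding index_tuples_def mem_Collect_eq by blast
qed

text \<open>Products over lists split along \<open>@\<close>, so an insertion needs no shifting of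
  indices.\<close>

lemma prod_nth_eq_prod_list:
  assumes "length xs = length ys"
  shows "(\<Prod>i<length ys. f (xs ! i) (ys ! i)) = prod_list (map2 f xs ys)"
  using assms
proof (induction xs ys rule: list_induct2)
  case (Cons x xs y ys)
  then show ?case by (simp add: prod.lessThan_Suc_shift del: prod.lessThan_Suc)
qed simp

lemma length_insert_zero_after [simp]: "length (insert_zero_after s as) = Suc (length as)"
  by (simp add: insert_zero_after_def)

text \<open>The new entry \<open>m\<close> meets the argument 0 and contributes the factor 1; it is
  placed after at least one entry, so the exponent \<open>hd ms\<close> survives.\<close>

lemma qmzv_term_insert_zero_after:
  assumes "length ms = length ns" "s < length ns"
    and "ms \<in> index_tuples (length ns)"
    and "take (Suc s) ms @ m # drop (Suc s) ms \<in> index_tuples (Suc (length ns))"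
  shows "qmzv_term (insert_zero_after (Suc s) ns) (take (Suc s) ms @ m # drop (Suc s) ms)
       = qmzv_term ns ms"
proof -
  let ?ms = "take (Suc s) ms @ m # drop (Suc s) ms"
  let ?ns = "insert_zero_after (Suc s) ns"
  have "prod_list (map2 qfactor ?ms ?ns) =
      prod_list (map2 qfactor (take (Suc s) ms @ drop (Suc s) ms) (take (Suc s) ns @ drop (Suc s) ns))"
    using assms(1) unfolding insert_zero_after_def
    by (subst (1 2) zip_append) (simp_all del: append_take_drop_id)
  then have "prod_list (map2 qfactor ?ms ?ns) = prod_list (map2 qfactor ms ns)"
    by simp
  moreover have "hd ?ms = hd ms"
    using assms(1,2) by (cases ms) auto
  ultimately show ?thesis
    using assms prod_nth_eq_prod_list[of ?ms ?ns qfactor] prod_nth_eq_prod_list[of ms ns qfactor]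
    by (simp add: qmzv_term_eq del: prod.lessThan_Suc)
qed

text \<open>Group the longer tuples by what remains after deleting the entry at position
  \<open>Suc s\<close>. The summand does not depend on that entry, so each group contributes its
  size, the number of integers in a gap.\<close>

lemma qmzv_insert_zero_after_nth:
  assumes "s < length ns"
  shows "fps_nth (qmzv (insert_zero_after (Suc s) ns)) n =
    (\<Sum>ms | ms \<in> index_tuples (length ns) \<and> hd ms \<le> n.
      (of_nat (ms ! s) - of_nat ((ms @ [0]) ! Suc s) - 1) * fps_nth (qmzv_term ns ms) n)"
proof -
  let ?k = "length ns"
  let ?A = "{ms. ms \<in> index_tuples ?k \<and> hd ms \<le> n}"
  let ?B = "{ms. ms \<in> index_tuples (Suc ?k) \<and> hd ms \<le> n}"
  let ?I = "\<lambda>ms. {(ms @ [0]) ! Suc s <..< ms ! s}"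
  let ?ins = "\<lambda>ms m. take (Suc s) ms @ m # drop (Suc s) ms"
  let ?del = "\<lambda>ms. take (Suc s) ms @ drop (Suc (Suc s)) ms"
  let ?c = "\<lambda>ns ms. fps_nth (qmzv_term ns ms) n"
  have len: "length ms = k" if "ms \<in> index_tuples k" for ms k
    using that by (simp add: index_tuples_def)
  have hd_take: "hd (take (Suc s) ms @ ys) = hd ms" if "ms \<noteq> []" for ms ys :: "nat list"
    using that by (cases ms) auto
  have ins_del: "?ins (?del ms) (ms ! Suc s) = ms" "length (?del ms) = ?k" "ms \<noteq> []"
    if "length ms = Suc ?k" for ms :: "nat list"
    using that assms by (auto simp: min_def id_take_nth_drop[of "Suc s" ms, symmetric])
  have del_ins: "?del (?ins ms m) = ms" "?ins ms m ! Suc s = m" "ms \<noteq> []"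
    if "length ms = ?k" for ms m
    using that assms by (auto simp: min_def nth_append)
  have "fps_nth (qmzv (insert_zero_after (Suc s) ns)) n =
      (\<Sum>ms\<in>?B. ?c (insert_zero_after (Suc s) ns) ms)"
    by (simp add: qmzv_nth)
  also have "\<dots> = (\<Sum>(ms, m)\<in>(SIGMA ms:?A. ?I ms). ?c ns ms)"
  proof (rule sum.reindex_bij_witness[where i = "\<lambda>(ms, m). ?ins ms m"
        and j = "\<lambda>ms. (?del ms, ms ! Suc s)"], goal_cases)
    case (1 ms)
    then show ?case by (simp only: mem_Collect_eq prod.case ins_del len)
  next
    case (2 ms)
    then have l: "length ms = Suc ?k" by (simp add: len)
    have "?ins (?del ms) (ms ! Suc s) \<in> index_tuples (Suc ?k)"
      using 2 l by (simp only: ins_del) simp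
    then have "?del ms \<in> index_tuples ?k \<and> ms ! Suc s \<in> ?I (?del ms)"
      using insert_index_tuples[of "?del ms" ?k s "ms ! Suc s"] ins_del(2)[OF l] assms by simp
    moreover have "hd (?del ms) \<le> n"
      using 2 hd_take[OF ins_del(3)[OF l]] by simp
    ultimately show ?case by simp
  next
    case (3 p)
    then show ?case by (auto simp only: mem_Sigma_iff mem_Collect_eq prod.case del_ins len split: prod.splits)
  next
    case (4 p)
    obtain ms m where p: "p = (ms, m)" by (cases p)
    have l: "length ms = ?k" using 4 p by (simp add: len)
    have "?ins ms m \<in> index_tuples (Suc ?k)"
      using 4 p insert_index_tuples[OF l assms, of m] by simp
    moreover have "hd (?ins ms m) \<le> n"
      using 4 p hd_take[OF del_ins(3)[OF l]] by simp
    ultimately show ?case by (simp add: p)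
  next
    case (5 ms)
    then have l: "length ms = Suc ?k" by (simp add: len)
    have t: "?ins (?del ms) (ms ! Suc s) \<in> index_tuples (Suc ?k)"
      using 5 l by (simp only: ins_del) simp
    then have "?del ms \<in> index_tuples ?k"
      using insert_index_tuples[of "?del ms" ?k s "ms ! Suc s"] ins_del(2)[OF l] assms by simp
    from qmzv_term_insert_zero_after[OF ins_del(2)[OF l] assms this t]
    show ?case unfolding ins_del(1)[OF l] by simp
  qed
  also have "\<dots> = (\<Sum>ms\<in>?A. \<Sum>m\<in>?I ms. ?c ns ms)"
    by (rule sum.Sigma[symmetric]) (use finite_index_tuples_hd_le in auto)
  also have "\<dots> = (\<Sum>ms\<in>?A. (of_nat (ms ! s) - of_nat ((ms @ [0]) ! Suc s) - 1) * ?c ns ms)"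
  proof (intro sum.cong refl)
    fix ms assume "ms \<in> ?A"
    \<comment> \<open>The strict inequality makes truncated subtraction in the cardinality of the
      gap agree with subtraction of rationals.\<close>
    then have "(ms @ [0]) ! Suc s < ms ! s"
      using assms by (auto simp: index_tuples_def nth_append sorted_wrt_iff_nth_less)
    then show "(\<Sum>m\<in>?I ms. ?c ns ms) =
        (of_nat (ms ! s) - of_nat ((ms @ [0]) ! Suc s) - 1) * ?c ns ms"
      by (simp add: of_nat_diff)
  qed
  finally show ?thesis .
qed

section \<open>Moments as zeta values, and the final formula\<close>

lemma qmzv_moment_eq:
  assumes "r < length ns"
  shows "qmzv_moment r ns =
    (\<Sum>s=r..<length ns. qmzv (insert_zero_after (Suc s) ns)) + of_nat (length ns - r) * qmzv ns"
proof (rule fps_ext)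
  fix n
  let ?k = "length ns"
  let ?A = "{ms. ms \<in> index_tuples ?k \<and> hd ms \<le> n}"
  let ?c = "\<lambda>ms. fps_nth (qmzv_term ns ms) n"
  have telescope: "(\<Sum>s=r..<?k. of_nat (ms ! s) - of_nat ((ms @ [0]) ! Suc s) - 1) + of_nat (?k - r)
      = (of_nat (ms ! r) :: rat)" if "ms \<in> ?A" for ms
  proof -
    have l: "length ms = ?k" using that by (simp add: index_tuples_def)
    let ?x = "\<lambda>s. of_nat ((ms @ [0]) ! s) :: rat"
    have "(\<Sum>s=r..<?k. of_nat (ms ! s) - ?x (Suc s) - 1) = (\<Sum>s=r..<?k. - (?x (Suc s) - ?x s) - 1)"
      using l by (intro sum.cong) (auto simp: nth_append)
    \<comment> \<open>The sum telescopes to the sentinel \<open>?x ?k = 0\<close>; the -1 from each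
      of the \<open>?k - r\<close> gaps accounts for the correction term.\<close>
    also have "\<dots> = - (?x ?k - ?x r) - of_nat (?k - r)"
      using sum_Suc_diff'[of r ?k ?x] assms by (simp only: sum_subtractf[of _ "\<lambda>_. 1"] sum_negf) simp
    finally show ?thesis
      using l assms by (simp add: nth_append)
  qed
  have "fps_nth ((\<Sum>s=r..<?k. qmzv (insert_zero_after (Suc s) ns)) + of_nat (?k - r) * qmzv ns) n =
     (\<Sum>ms\<in>?A. ((\<Sum>s=r..<?k. of_nat (ms ! s) - of_nat ((ms @ [0]) ! Suc s) - 1) + of_nat (?k - r)) * ?c ms)"
    unfolding fps_add_nth fps_sum_nth nth_of_nat_mult qmzv_nth[of ns]
    by (simp add: qmzv_insert_zero_after_nth distrib_right sum.distrib sum_distrib_right sum_distrib_left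
        sum.swap[of _ ?A])
  also have "\<dots> = (\<Sum>ms\<in>?A. of_nat (ms ! r) * ?c ms)"
    by (intro sum.cong refl) (simp only: telescope)
  also have "\<dots> = fps_nth (qmzv_moment r ns) n"
    by (simp add: qmzv_moment_def)
  finally show "fps_nth (qmzv_moment r ns) n =
    fps_nth ((\<Sum>s=r..<?k. qmzv (insert_zero_after (Suc s) ns)) + of_nat (?k - r) * qmzv ns) n" by simp
qed

text \<open>The moments yield double sums grouped by the raised argument \<open>r\<close>, whereas
  the final formula groups them by the insertion position \<open>s\<close>.\<close>

lemma sum_triangle_swap:
  fixes f :: "nat \<Rightarrow> nat \<Rightarrow> 'a::comm_monoid_add"
  shows "(\<Sum>s<k. \<Sum>r<Suc s. f r s) = (\<Sum>r<k. \<Sum>s=r..<k. f r s)"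
  unfolding sum.Sigma[OF finite_lessThan ballI[OF finite_lessThan]]
    sum.Sigma[OF finite_lessThan ballI[OF finite_atLeastLessThan]]
  by (rule sum.reindex_bij_witness[where i = "\<lambda>(x, y). (y, x)" and j = "\<lambda>(x, y). (y, x)"]) auto

theorem proposition12:
  fixes k :: nat and a :: "int list"
  assumes "k \<ge> 1" and "length a = k"
  shows "q_deriv (qmzv a) =
      of_int (int k - (\<Sum>r=1..k. a ! (r - 1) * (int k - int r + 1))) * qmzv a
    + (\<Sum>r=1..k. of_int (a ! (r - 1) * (int k - int r + 1)) * qmzv (incr_arg r a))
    + (\<Sum>s=1..k. of_int (1 - (\<Sum>r=1..s. a ! (r - 1))) * qmzv (insert_zero_after s a))
    + (\<Sum>s=1..k. \<Sum>r=1..s. of_int (a ! (r - 1)) * qmzv (insert_zero_after s (incr_arg r a)))"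
proof -
  let ?A = "\<lambda>r. of_int (a ! r) :: rat fps"
  let ?Z = "\<lambda>s. qmzv (insert_zero_after (Suc s) a)"
  let ?Z' = "\<lambda>r s. qmzv (insert_zero_after (Suc s) (incr_arg (Suc r) a))"
  let ?q = "\<lambda>r. qmzv (incr_arg (Suc r) a)"
  \<comment> \<open>The first two terms come from the moment of index 0, which involves every
    insertion position.\<close>
  have "q_deriv (qmzv a) = (\<Sum>s<k. ?Z s) + of_nat k * qmzv a
     + (\<Sum>r<k. ?A r * ((\<Sum>s=r..<k. ?Z' r s) + of_nat (k - r) * ?q r
          - ((\<Sum>s=r..<k. ?Z s) + of_nat (k - r) * qmzv a)))"
    using assms by (subst q_deriv_qmzv) (auto simp: qmzv_moment_eq lessThan_atLeast0 intro!: sum.cong)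
  also have "\<dots> = of_nat k * qmzv a - (\<Sum>r<k. ?A r * of_nat (k - r)) * qmzv a
     + (\<Sum>r<k. ?A r * of_nat (k - r) * ?q r)
     + ((\<Sum>s<k. ?Z s) - (\<Sum>r<k. \<Sum>s=r..<k. ?A r * ?Z s))
     + (\<Sum>r<k. \<Sum>s=r..<k. ?A r * ?Z' r s)"
    by (simp add: algebra_simps sum.distrib sum_subtractf sum_distrib_left sum_distrib_right)
  also have "\<dots> = of_nat k * qmzv a - (\<Sum>r<k. ?A r * of_nat (k - r)) * qmzv a
     + (\<Sum>r<k. ?A r * of_nat (k - r) * ?q r)
     + (\<Sum>s<k. (1 - (\<Sum>r<Suc s. ?A r)) * ?Z s)
     + (\<Sum>s<k. \<Sum>r<Suc s. ?A r * ?Z' r s)"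
    unfolding sum_triangle_swap[symmetric]
    by (simp add: left_diff_distrib sum_subtractf sum_distrib_right del: sum.lessThan_Suc)
  \<comment> \<open>Counting positions from 1 instead of 0 turns the weight \<open>k - r\<close>
    into \<open>k - r + 1\<close>.\<close>
  also have "(\<Sum>r<k. ?A r * of_nat (k - r)) = of_int (\<Sum>r=1..k. a ! (r - 1) * (int k - int r + 1))"
    by (simp add: sum.atLeast1_atMost_eq of_nat_diff algebra_simps)
  also have "(\<Sum>r<k. ?A r * of_nat (k - r) * ?q r) =
      (\<Sum>r=1..k. of_int (a ! (r - 1) * (int k - int r + 1)) * qmzv (incr_arg r a))"
    by (simp add: sum.atLeast1_atMost_eq of_nat_diff algebra_simps)
  finally show ?thesis
    by (simp add: sum.atLeast1_atMost_eq left_diff_distrib del: sum.lessThan_Suc)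
qed

end
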